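(* Let $C\in\mathbb{C}^{n\times n}$. Then $$r(C)=\min\left\{c:\ c\in\mathbb{R},\ Z\in\mathrm{H}_n,\ \begin{bmatrix} cI_n+Z& C\\ C^*& cI_n-Z\end{bmatrix}\in \mathrm{H}_{2n,+}\right\}.$$
   Context: $\mathrm{H}_n$ denotes the real space of $n\times n$ complex Hermitian matrices, $\mathrm{H}_{k,+}$ the closed cone of $k\times k$ complex Hermitian positive semidefinite matrices, and $I_n$ the $n\times n$ identity matrix. For $C\in\mathbb{C}^{n\times n}$ the numerical radius is $r(C)=\max\{|\mathbf{x}^*C\mathbf{x}|:\ \mathbf{x}\in\mathbb{C}^n,\ \|\mathbf{x}\|=1\}$, where $\|\mathbf{x}\|=\sqrt{\mathbf{x}^*\mathbf{x}}$. *)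

theory Defs
  imports "HOL-Analysis.Analysis"
begin

definition cdot :: "complex ^ 'n \<Rightarrow> complex ^ 'n \<Rightarrow> complex"
  where "cdot x y = (\<Sum>i\<in>UNIV. cnj (x $ i) * y $ i)"

definition ctranspose :: "complex ^ 'n ^ 'm \<Rightarrow> complex ^ 'm ^ 'n"
  where "ctranspose A = (\<chi> i j. cnj (A $ j $ i))"

definition herm_mats :: "(complex ^ 'n ^ 'n) set"
  where "herm_mats = {A. ctranspose A = A}"

(* The quadratic form of a Hermitian matrix is real-valued, so taking Re loses nothing. *)
definition psd_mats :: "(complex ^ 'n ^ 'n) set"
  where "psd_mats = {A \<in> herm_mats. \<forall>x. 0 \<le> Re (cdot x (A *v x))}"

(* The sum type 'm + 'n indexes the rows and columns, Inl being the first block. *)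
definition block_mat ::
    "'a ^ 'm ^ 'm \<Rightarrow> 'a ^ 'n ^ 'm \<Rightarrow> 'a ^ 'm ^ 'n \<Rightarrow> 'a ^ 'n ^ 'n \<Rightarrow> 'a ^ ('m + 'n) ^ ('m + 'n)"
  where "block_mat A B C D = (\<chi> i j.
    (case i of
       Inl p \<Rightarrow> (case j of Inl q \<Rightarrow> A $ p $ q | Inr q \<Rightarrow> B $ p $ q)
     | Inr p \<Rightarrow> (case j of Inl q \<Rightarrow> C $ p $ q | Inr q \<Rightarrow> D $ p $ q)))"

(* Stated as a supremum; numerical_radius_attained and numerical_radius_upper
   below show that it is the maximum. *)
definition numerical_radius :: "complex ^ 'n ^ 'n \<Rightarrow> real"
  where "numerical_radius C = (SUP x\<in>{x. norm x = 1}. cmod (cdot x (C *v x)))"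

definition is_minimum :: "'a::order set \<Rightarrow> 'a \<Rightarrow> bool"
  where "is_minimum S m \<longleftrightarrow> m \<in> S \<and> (\<forall>s\<in>S. m \<le> s)"

lemma norm_eq_sqrt_cdot: "complex_of_real (norm x) = csqrt (cdot x x)"
proof -
  have "cdot x x = complex_of_real ((norm x)\<^sup>2)"
    by (simp add: cdot_def norm_vec_def L2_set_def sum_nonneg complex_norm_square mult.commute
        del: of_real_power)
  then show ?thesis
    by (simp add: csqrt_of_real_nonneg del: of_real_power)
qed

lemma
  fixes C :: "complex ^ 'n ^ 'n"
  shows numerical_radius_attained:
      "\<exists>x. norm x = 1 \<and> cmod (cdot x (C *v x)) = numerical_radius C"
    and numerical_radius_upper:
      "norm x = 1 \<Longrightarrow> cmod (cdot x (C *v x)) \<le> numerical_radius C"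
proof -
  define f where "f = (\<lambda>x. cmod (cdot x (C *v x)))"
  let ?S = "{x :: complex ^ 'n. norm x = 1}"
  have "?S = sphere 0 1" by (auto simp: sphere_def)
  then have S: "compact ?S" by simp
  have ne: "?S \<noteq> {}"
    using vector_choose_size[of 1, where 'a = "complex ^ 'n"] by auto
  have cont: "continuous_on ?S f"
    unfolding f_def cdot_def matrix_vector_mult_def
    by (intro continuous_intros)
  obtain x0 where x0: "norm x0 = 1" "\<And>x. norm x = 1 \<Longrightarrow> f x \<le> f x0"
    using continuous_attains_sup[OF S ne cont] by blast
  have "(SUP x\<in>?S. f x) = f x0"
    using x0 by (intro cSup_eq_maximum) auto
  then have eq: "numerical_radius C = f x0"
    by (simp add: numerical_radius_def f_def)
  show "\<exists>x. norm x = 1 \<and> cmod (cdot x (C *v x)) = numerical_radius C"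
    using x0(1) eq by (auto simp: f_def)
  show "cmod (cdot x (C *v x)) \<le> numerical_radius C" if "norm x = 1"
    using x0(2)[OF that] eq by (simp add: f_def)
qed

end

theory Submission
  imports Defs
begin

text \<open>
  Write \<open>r\<close> for the numerical radius of \<open>C\<close> and \<open>\<langle>x, y\<rangle>\<close> for \<open>cdot x y\<close>.

  No feasible \<open>c\<close> is smaller than \<open>r\<close>: take a unit vector \<open>x\<close> at which \<open>r\<close> is attained and test the
  block matrix on the vector with blocks \<open>x\<close> and \<open>a x\<close>, where the unimodular \<open>a\<close> turns
  \<open>\<langle>x, C x\<rangle>\<close> into \<open>-r\<close>. The two copies of \<open>Z\<close> cancel and \<open>2 c - 2 r \<ge> 0\<close> remains.

  The substance is the construction of \<open>Z\<close> for \<open>c \<ge> r\<close>. It suffices to find a Hermitian \<open>X\<close> with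
  \<open>\<langle>x, X x\<rangle> \<le> 2 c |x|^2 + 2 Re \<langle>x, C y\<rangle> + \<langle>y, X y\<rangle>\<close> for all \<open>x\<close> and \<open>y\<close>,
  because this says that the block matrix with \<open>Z = c I - X\<close> is positive semidefinite. This
  inequality is one half of the Bellman equation of a minimization problem over an infinite chain of
  vectors: let \<open>q x\<close> be the infimum, over finitely supported sequences \<open>s\<close> with \<open>s 0 = x\<close>, of
  \<open>\<Sum>k. 2 c |s k|^2 + 2 Re \<langle>s k, C s (k + 1)\<rangle>\<close>. This sum is
  the quadratic form of the block Toeplitz matrix with symbol
  \<open>2 c I + e^{-it} C + e^{it} C^*\<close>. The symbol is positive semidefinite at every \<open>t\<close> exactly because
  \<open>c \<ge> r\<close>, so passing to Fourier coefficients shows that the form is nonnegative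
  (\<open>toeplitz_form_nonneg\<close>) and the infimum is finite. Prepending \<open>x\<close> to a sequence that starts in \<open>y\<close>
  gives the inequality for \<open>q\<close> (\<open>toeplitz_min_Bellman\<close>).

  It remains to see that \<open>q\<close> is the form of a matrix. Minimizing a form over part of its
  variables preserves the parallelogram law (\<open>toeplitz_min_parallelogram\<close>), and the theorem of
  Jordan and von Neumann turns the law, together with homogeneity and boundedness, into a
  Hermitian matrix (\<open>Hermitian_matrix_of_quadratic_form\<close>). This \<open>X\<close> is the Schur complement that
  one would obtain by eliminating the tail of the Toeplitz matrix; the variational definition
  avoids inverting possibly singular blocks and a limit over finite sections.
\<close>

section \<open>Sesquilinear algebra\<close>

lemma cdot_add_left: "cdot (x + y) z = cdot x z + cdot y z"
  by (simp add: cdot_def algebra_simps sum.distrib)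

lemma cdot_add_right: "cdot x (y + z) = cdot x y + cdot x z"
  by (simp add: cdot_def algebra_simps sum.distrib)

lemma cdot_diff_left: "cdot (x - y) z = cdot x z - cdot y z"
  by (simp add: cdot_def algebra_simps sum_subtractf)

lemma cdot_diff_right: "cdot x (y - z) = cdot x y - cdot x z"
  by (simp add: cdot_def algebra_simps sum_subtractf)

lemma cdot_scale_left: "cdot (a *s x) y = cnj a * cdot x y"
  by (simp add: cdot_def sum_distrib_left mult_ac)

lemma cdot_scale_right: "cdot x (a *s y) = a * cdot x y"
  by (simp add: cdot_def sum_distrib_left mult_ac)

lemma cdot_sum_left: "cdot (\<Sum>i\<in>S. f i) y = (\<Sum>i\<in>S. cdot (f i) y)"
  by (simp add: cdot_def sum_distrib_right sum.swap[of _ S])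

lemma cdot_sum_right: "cdot y (\<Sum>i\<in>S. f i) = (\<Sum>i\<in>S. cdot y (f i))"
  by (simp add: cdot_def sum_distrib_left sum.swap[of _ S])

lemma cdot_zero [simp]: "cdot 0 y = 0" "cdot y 0 = 0"
  by (simp_all add: cdot_def)

lemma cdot_self: "cdot x x = complex_of_real ((norm x)\<^sup>2)"
  by (simp add: cdot_def norm_vec_def L2_set_def sum_nonneg complex_norm_square mult.commute
      del: of_real_power)

lemma norm_sq_eq_Re_cdot: "(norm x)\<^sup>2 = Re (cdot x x)"
  by (simp add: cdot_self del: of_real_power)

lemma norm_scale: "norm (a *s x) = cmod a * norm (x :: complex ^ 'n)"
proof -
  have "(norm (a *s x))\<^sup>2 = Re (a * cnj a * cdot x x)"
    by (simp add: norm_sq_eq_Re_cdot[of "a *s x"] cdot_scale_left cdot_scale_right mult_ac)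
  also have "a * cnj a * cdot x x = of_real ((cmod a * norm x)\<^sup>2)"
    by (simp only: cdot_self complex_norm_square[symmetric] power_mult_distrib of_real_mult)
  finally have "(norm (a *s x))\<^sup>2 = (cmod a * norm x)\<^sup>2"
    by (simp only: Re_complex_of_real)
  then show ?thesis by simp
qed

lemma cdot_ctranspose: "cdot x (ctranspose A *v y) = cnj (cdot y (A *v x))"
proof -
  have "cdot x (ctranspose A *v y) = (\<Sum>i\<in>UNIV. \<Sum>j\<in>UNIV. cnj (x $ i) * (cnj (A $ j $ i) * y $ j))"
    by (simp add: cdot_def ctranspose_def matrix_vector_mult_def sum_distrib_left)
  also have "\<dots> = (\<Sum>j\<in>UNIV. \<Sum>i\<in>UNIV. cnj (x $ i) * (cnj (A $ j $ i) * y $ j))"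
    by (rule sum.swap)
  also have "\<dots> = cnj (cdot y (A *v x))"
    by (simp add: cdot_def matrix_vector_mult_def sum_distrib_left mult_ac)
  finally show ?thesis .
qed

lemma ctranspose_block_mat:
  "ctranspose (block_mat A B C D) =
     block_mat (ctranspose A) (ctranspose C) (ctranspose B) (ctranspose D)"
  by (simp add: vec_eq_iff block_mat_def ctranspose_def split: sum.split)

lemma sum_UNIV_sum_type:
  fixes f :: "'m::finite + 'n::finite \<Rightarrow> 'b::comm_monoid_add"
  shows "(\<Sum>i\<in>UNIV. f i) = (\<Sum>p\<in>UNIV. f (Inl p)) + (\<Sum>q\<in>UNIV. f (Inr q))"
  by (subst UNIV_Plus_UNIV[symmetric], subst sum.Plus) (auto simp: o_def)

lemma cdot_block_mat:
  fixes A :: "complex ^ 'm ^ 'm" and D :: "complex ^ 'n ^ 'n"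
  defines "fst_part \<equiv> \<lambda>v :: complex ^ ('m + 'n). \<chi> p. v $ Inl p"
    and "snd_part \<equiv> \<lambda>v :: complex ^ ('m + 'n). \<chi> q. v $ Inr q"
  shows "cdot v (block_mat A B C D *v v) =
      cdot (fst_part v) (A *v fst_part v) + cdot (fst_part v) (B *v snd_part v)
    + cdot (snd_part v) (C *v fst_part v) + cdot (snd_part v) (D *v snd_part v)"
  by (simp add: cdot_def matrix_vector_mult_def block_mat_def fst_part_def snd_part_def
      sum_UNIV_sum_type algebra_simps sum.distrib)

lemma cmod_cdot_le_numerical_radius:
  "cmod (cdot x (C *v x)) \<le> numerical_radius C * (norm x)\<^sup>2"
proof (cases "x = 0")
  case False
  define a where "a = complex_of_real (1 / norm x)"
  have "norm (a *s x) = 1"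
    using False by (simp add: norm_scale a_def norm_divide)
  from numerical_radius_upper[OF this, of C]
  have "(cmod a)\<^sup>2 * cmod (cdot x (C *v x)) \<le> numerical_radius C"
    by (simp add: vec.scale cdot_scale_left cdot_scale_right norm_mult power2_eq_square)
  then show ?thesis
    using False by (simp add: a_def norm_divide power_divide field_simps)
qed simp

section \<open>Quadratic forms come from Hermitian matrices\<close>

text \<open>
  The deviation of \<open>f\<close> from linearity is additive and vanishes on the integers, so it has period 1 and
  is bounded on the whole line; an additive function bounded on the line is zero, since its values at
  the multiples of a point grow linearly.
\<close>

lemma bounded_additive_real_linear:
  fixes f :: "real \<Rightarrow> real"
  assumes add: "\<And>s t. f (s + t) = f s + f t"
    and bdd: "\<And>t. 0 \<le> t \<Longrightarrow> t \<le> 1 \<Longrightarrow> \<bar>f t\<bar> \<le> K"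
  shows "f t = t * f 1"
proof -
  define h where "h t = f t - t * f 1" for t
  have hadd: "h (s + t) = h s + h t" for s t
    by (simp add: h_def add algebra_simps)
  interpret h: additive h by standard (rule hadd)
  have hnat: "h (real n * t) = real n * h t" for n t
    by (induction n) (simp_all add: algebra_simps hadd h.zero)
  have "h 1 = 0" by (simp add: h_def)
  have hint: "h (of_int k) = 0" for k
  proof (cases "k \<ge> 0")
    case True
    then show ?thesis using hnat[of "nat k" 1] \<open>h 1 = 0\<close> by simp
  next
    case False
    then show ?thesis using hnat[of "nat (-k)" 1] \<open>h 1 = 0\<close> h.minus[of "of_int k"] by simp
  qed
  have hbdd: "\<bar>h t\<bar> \<le> K + \<bar>f 1\<bar>" for t
  proof -
    have "h t = h (frac t)"
      using hadd[of "of_int \<lfloor>t\<rfloor>" "frac t"] hint by (simp add: frac_def)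
    moreover have "\<bar>f (frac t)\<bar> \<le> K"
      by (rule bdd) (simp_all add: frac_ge_0 less_imp_le[OF frac_lt_1])
    moreover have "\<bar>frac t * f 1\<bar> \<le> 1 * \<bar>f 1\<bar>"
      unfolding abs_mult by (rule mult_right_mono) (simp_all add: less_imp_le[OF frac_lt_1])
    ultimately show ?thesis unfolding h_def by linarith
  qed
  have "h t = 0"
  proof (rule ccontr)
    assume "h t \<noteq> 0"
    then obtain n where "K + \<bar>f 1\<bar> < real n * \<bar>h t\<bar>"
      using reals_Archimedean3[of "\<bar>h t\<bar>"] by auto
    with hbdd[of "real n * t"] show False by (simp add: hnat abs_mult)
  qed
  then show ?thesis by (simp add: h_def)
qed

text \<open>
  The theorem of Jordan and von Neumann, for forms that may be degenerate. Polarization produces a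
  symmetric \<open>B\<close>, which the parallelogram law makes biadditive and which boundedness of \<open>q\<close> makes real
  bilinear. Invariance of \<open>q\<close> under multiplication by \<open>\<i>\<close> then lets \<open>B\<close> be completed to a
  sesquilinear form with real part \<open>B\<close>, whose Gram matrix on the standard basis is \<open>X\<close>.
\<close>

lemma Hermitian_matrix_of_quadratic_form:
  fixes q :: "complex ^ 'n \<Rightarrow> real"
  assumes par: "\<And>x y. q (x + y) + q (x - y) = 2 * q x + 2 * q y"
    and hom: "\<And>a x. q (a *s x) = (cmod a)\<^sup>2 * q x"
    and bdd: "\<And>x. \<bar>q x\<bar> \<le> K * (norm x)\<^sup>2"
  obtains X where "X \<in> herm_mats" "\<And>x. cdot x (X *v x) = complex_of_real (q x)"
proof -
  define B where "B x y = (q (x + y) - q (x - y)) / 4" for x y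
  have q0: "q 0 = 0" using hom[of 0 0] by simp
  have q2: "q (x + x) = 4 * q x" for x
    using par[of x x] by (simp only: q0 diff_self)
  have qminus: "q (- x) = q x" for x using hom[of "-1" x] by (simp add: vec.scale_minus_left)
  have Bsym: "B x y = B y x" for x y
    using qminus[of "x - y"] by (simp add: B_def add.commute)
  have Bdiag: "B x x = q x" for x unfolding B_def q2 diff_self q0 by simp
  have B0: "B 0 y = 0" for y by (simp add: B_def qminus)
  \<comment> \<open>The additivity of \<open>B\<close> in midpoint form; substituting the half sum and the half difference
    of two vectors turns it into ordinary additivity.\<close>
  have Bmid: "B (x + z) y + B (x - z) y = 2 * B x y" for x y z
  proof -
    have "q (x + z + y) + q (x - z + y) = 2 * q (x + y) + 2 * q z"
      using par[of "x + y" z] by (simp add: algebra_simps)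
    moreover have "q (x + z - y) + q (x - z - y) = 2 * q (x - y) + 2 * q z"
      using par[of "x - y" z] by (simp add: algebra_simps)
    ultimately show ?thesis unfolding B_def by argo
  qed
  have Bdouble: "B (x + x) y = 2 * B x y" for x y
    using Bmid[of x x y] B0 by simp
  have Badd_left: "B (x + z) y = B x y + B z y" for x y z
  proof -
    define u v where "u = (1/2 :: real) *\<^sub>R (x + z)" and "v = (1/2 :: real) *\<^sub>R (x - z)"
    have *: "u + v = x" "u - v = z" "u + u = x + z"
      by (simp_all add: u_def v_def vec_eq_iff field_simps flip: scaleR_add_left)
    show ?thesis using Bmid[of u v y] Bdouble[of u y] by (simp add: *)
  qed
  have Badd: "B y (x + z) = B y x + B y z" for x y z
    using Badd_left by (simp add: Bsym[of y])
  have Bscale: "B x (of_real t *s y) = t * B x y" for x y t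
  proof -
    have "B x (of_real t *s y) = t * B x (of_real 1 *s y)"
    proof (rule bounded_additive_real_linear[where f = "\<lambda>t. B x (of_real t *s y)"])
      show "B x (of_real (s + t) *s y) = B x (of_real s *s y) + B x (of_real t *s y)" for s t
        by (simp add: Badd vec.scale_left_distrib)
      show "\<bar>B x (of_real t *s y)\<bar> \<le> \<bar>K\<bar> * (norm x + norm y)\<^sup>2" if "0 \<le> t" "t \<le> 1" for t
      proof -
        let ?y = "complex_of_real t *s y"
        have "norm ?y \<le> norm y"
          using that by (simp add: norm_scale mult_left_le_one_le)
        then have n: "norm (x + ?y) \<le> norm x + norm y" "norm (x - ?y) \<le> norm x + norm y"
          using norm_triangle_ineq[of x ?y] norm_triangle_ineq4[of x ?y] by linarith+
        have "\<bar>q z\<bar> \<le> \<bar>K\<bar> * (norm x + norm y)\<^sup>2" if "norm z \<le> norm x + norm y" for z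
        proof -
          have "\<bar>q z\<bar> \<le> K * (norm z)\<^sup>2" by (rule bdd)
          also have "\<dots> \<le> \<bar>K\<bar> * (norm x + norm y)\<^sup>2"
            using that by (intro mult_mono power_mono) auto
          finally show ?thesis .
        qed
        from this[OF n(1)] this[OF n(2)] show ?thesis by (simp add: B_def)
      qed
    qed
    then show ?thesis by simp
  qed
  have Bi: "B (\<i> *s x) (\<i> *s y) = B x y" for x y
    using hom[of \<i> "x + y"] hom[of \<i> "x - y"]
    by (simp add: B_def vec.scale_right_distrib vec.scale_right_diff_distrib)
  \<comment> \<open>The imaginary part is forced: \<open>S\<close> has to be complex linear in its second argument, so
    \<open>Im (S x y)\<close> equals \<open>- Re (S x (\<i> y))\<close>.\<close>
  define S where "S x y = Complex (B x y) (- B x (\<i> *s y))" for x y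
  have Sadd: "S x (y + z) = S x y + S x z" for x y z
    by (simp add: S_def complex_eq_iff Badd vec.scale_right_distrib)
  have Sscale: "S x (a *s y) = a * S x y" for x y a
  proof -
    have a: "a *s y = of_real (Re a) *s y + of_real (Im a) *s (\<i> *s y)"
      by (simp add: vec_eq_iff complex_eq_iff)
    have ia: "\<i> *s (a *s y) = of_real (- Im a) *s y + of_real (Re a) *s (\<i> *s y)"
      by (simp add: vec_eq_iff complex_eq_iff)
    have "B x (a *s y) = Re a * B x y + Im a * B x (\<i> *s y)"
      unfolding a by (simp only: Badd Bscale)
    moreover have "B x (\<i> *s (a *s y)) = - Im a * B x y + Re a * B x (\<i> *s y)"
      unfolding ia by (simp only: Badd Bscale)
    ultimately show ?thesis by (simp add: S_def complex_eq_iff algebra_simps)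
  qed
  have Bneg: "B x (- y) = - B x y" for x y
    using Bscale[of x "-1" y] by (simp add: vec.scale_minus_left)
  have Scnj: "S y x = cnj (S x y)" for x y
  proof -
    have "\<i> *s (\<i> *s y) = - y" by (simp add: vec_eq_iff)
    then have "B y (\<i> *s x) = - B x (\<i> *s y)"
      using Bi[of x "\<i> *s y"] Bneg[of "\<i> *s x" y] Bsym[of y "\<i> *s x"] by simp
    then show ?thesis by (simp add: S_def complex_eq_iff Bsym[of y x])
  qed
  have Ssum: "S x (\<Sum>i\<in>I. f i) = (\<Sum>i\<in>I. S x (f i))" if "finite I" for x I and f :: "'n \<Rightarrow> _"
    using that
  proof induction
    case empty
    show ?case using Sscale[of x 0 0] by simp
  qed (simp add: Sadd)
  define X where "X = (\<chi> i j. S (axis i 1) (axis j 1))"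
  have expand: "y = (\<Sum>i\<in>UNIV. y $ i *s axis i 1)" for y :: "complex ^ 'n"
    by (simp add: basis_expansion)
  have S1: "S x y = (\<Sum>j\<in>UNIV. y $ j * S x (axis j 1))" for x y
    using arg_cong[OF expand[of y], of "S x"] by (simp only: Ssum[OF finite] Sscale)
  have X_flip: "X $ i $ j = cnj (S (axis j 1) (axis i 1))" for i j
    by (simp add: X_def) (rule Scnj)
  have "cdot x (X *v y) = S x y" for x y
  proof -
    have "S x y = (\<Sum>j\<in>UNIV. y $ j * cnj (S (axis j 1) x))"
      by (simp only: S1[of x y] Scnj[of x "axis _ 1"] complex_cnj_cnj)
    also have "\<dots> = (\<Sum>j\<in>UNIV. \<Sum>i\<in>UNIV. cnj (x $ i) * (X $ i $ j * y $ j))"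
      by (simp add: X_flip S1[of _ x] sum_distrib_left mult_ac)
    also have "\<dots> = cdot x (X *v y)"
      by (subst sum.swap) (simp add: cdot_def matrix_vector_mult_def sum_distrib_left)
    finally show ?thesis by (rule sym)
  qed
  moreover have "S x x = complex_of_real (q x)" for x
  proof -
    have "Im (S x x) = 0" using Scnj[of x x] by (simp add: complex_eq_iff)
    then show ?thesis by (simp add: S_def complex_eq_iff Bdiag)
  qed
  moreover have "X \<in> herm_mats"
    by (simp add: herm_mats_def ctranspose_def X_def vec_eq_iff flip: Scnj)
  ultimately show ?thesis using that by simp
qed

section \<open>The Toeplitz form\<close>

text \<open>
  Summing over the support gives one expression for all finitely supported sequences, with no
  length parameter; indices outside the support contribute nothing, which
  \<open>toeplitz_form_eq_sum\<close> uses to bring several sequences to a common range.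
\<close>

definition toeplitz_form :: "real \<Rightarrow> complex ^ 'n ^ 'n \<Rightarrow> (nat \<Rightarrow> complex ^ 'n) \<Rightarrow> real" where
  "toeplitz_form c C s =
    (\<Sum>k | s k \<noteq> 0. 2 * c * (norm (s k))\<^sup>2 + 2 * Re (cdot (s k) (C *v s (Suc k))))"

lemma toeplitz_form_eq_sum:
  assumes "\<And>k. k \<ge> N \<Longrightarrow> s k = 0"
  shows "toeplitz_form c C s =
    (\<Sum>k<N. 2 * c * (norm (s k))\<^sup>2 + 2 * Re (cdot (s k) (C *v s (Suc k))))"
  unfolding toeplitz_form_def
  by (rule sum.mono_neutral_left) (use assms in \<open>auto simp: not_le[symmetric]\<close>)

lemma finite_support_bound:
  fixes s :: "nat \<Rightarrow> 'a::zero"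
  assumes "finite {k. s k \<noteq> 0}"
  obtains N where "\<And>k. k \<ge> N \<Longrightarrow> s k = 0"
  using assms unfolding finite_nat_set_iff_bounded by (metis mem_Collect_eq not_le)

lemma sum_roots_of_unity:
  fixes j :: int
  assumes "\<bar>j\<bar> < int M"
  shows "(\<Sum>m<M. cis (2 * pi * real m * of_int j / real M)) = (if j = 0 then of_nat M else 0)"
proof (cases "j = 0")
  case False
  define z where "z = cis (2 * pi * of_int j / real M)"
  have M: "M > 0" using assms by auto
  have "z ^ M = cis (2 * pi * of_int j)"
  proof -
    have "real M * (2 * pi * of_int j / real M) = 2 * pi * of_int j" using M by simp
    then show ?thesis by (simp only: z_def Complex.DeMoivre)
  qed
  then have zM: "z ^ M = 1"
    by (simp add: cis_multiple_2pi)
  have z1: "z \<noteq> 1"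
  proof
    assume "z = 1"
    then obtain k :: int where "2 * pi * of_int j / real M = of_int k * (2 * pi)"
      unfolding z_def cis_conv_exp exp_eq_1 by auto
    then have "real_of_int j = of_int (k * int M)" using M by (simp add: field_simps)
    then have "j = k * int M" by (simp only: of_int_eq_iff)
    with assms False show False using zdvd_imp_le[of "int M" "\<bar>j\<bar>"] by auto
  qed
  have "(\<Sum>m<M. cis (2 * pi * real m * of_int j / real M)) = (\<Sum>m<M. z ^ m)"
    by (simp add: z_def Complex.DeMoivre mult_ac)
  also have "\<dots> = 0" using z1 zM by (simp add: geometric_sum)
  finally show ?thesis using False by simp
qed simp

text \<open>
  Averaging over the \<open>M\<close>-th roots of unity extracts the \<open>d\<close>-th diagonal of a matrix. Since \<open>M\<close>
  exceeds every offset \<open>|l - k - d|\<close> that occurs, no other diagonal is congruent to it modulo \<open>M\<close>.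
\<close>

lemma discrete_fourier_average:
  fixes a :: "nat \<Rightarrow> nat \<Rightarrow> complex"
  assumes "N + d \<le> M" and zero: "\<And>k l. l \<ge> N \<Longrightarrow> a k l = 0"
  shows "(\<Sum>m<M. \<Sum>k<N. \<Sum>l<N. cis (2 * pi * real m * (real l - real k - real d) / real M) * a k l)
       = of_nat M * (\<Sum>k<N. a k (k + d))"
proof -
  have "(\<Sum>m<M. \<Sum>k<N. \<Sum>l<N. cis (2 * pi * real m * (real l - real k - real d) / real M) * a k l)
    = (\<Sum>k<N. \<Sum>l<N. (\<Sum>m<M. cis (2 * pi * real m * of_int (int l - int k - int d) / real M)) * a k l)"
    by (subst sum.swap, rule sum.cong[OF refl], subst sum.swap) (simp add: sum_distrib_right)
  also have "\<dots> = (\<Sum>k<N. \<Sum>l<N. if l = k + d then of_nat M * a k l else 0)"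
  proof (intro sum.cong refl)
    fix k l assume "k \<in> {..<N}" "l \<in> {..<N}"
    then have "\<bar>int l - int k - int d\<bar> < int M" using assms(1) by auto
    from sum_roots_of_unity[OF this]
    show "(\<Sum>m<M. cis (2 * pi * real m * of_int (int l - int k - int d) / real M)) * a k l
        = (if l = k + d then of_nat M * a k l else 0)"
      by auto
  qed
  also have "\<dots> = (\<Sum>k<N. of_nat M * a k (k + d))"
    by (intro sum.cong refl) (auto simp: sum.delta zero)
  finally show ?thesis by (simp add: sum_distrib_left)
qed

text \<open>
  Up to a factor, the form is the sum, over the roots of unity \<open>w\<close>, of
  \<open>2 c |y|^2 + 2 Re (w^{-1} \<langle>y, C y\<rangle>)\<close> at the discrete Fourier transform \<open>y\<close> of \<open>s\<close>. Each summand is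
  nonnegative, as \<open>|\<langle>y, C y\<rangle>|\<close> is at most the numerical radius times \<open>|y|^2\<close>.
\<close>

lemma toeplitz_form_nonneg:
  assumes fin: "finite {k. s k \<noteq> 0}" and c: "numerical_radius C \<le> c"
  shows "0 \<le> toeplitz_form c C s"
proof -
  obtain N where N: "\<And>k. k \<ge> N \<Longrightarrow> s k = 0"
    using finite_support_bound[OF fin] by blast
  \<comment> \<open>One more root than the length of \<open>s\<close>, because the coupling of neighbours shifts the
    offsets by one.\<close>
  define M where "M = Suc N"
  define w where "w m r = cis (2 * pi * real m * r / real M)" for m r
  define y where "y m = (\<Sum>k<N. w m (real k) *s s k)" for m
  have w_mult: "w m a * w m b = w m (a + b)" and w_cnj: "cnj (w m a) = w m (- a)"
    and w_norm: "cmod (w m a) = 1" for m a b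
    by (simp_all add: w_def cis_mult cis_cnj algebra_simps add_divide_distrib)
  have form: "cdot (y m) (A *v y m) = (\<Sum>k<N. \<Sum>l<N. w m (real l - real k) * cdot (s k) (A *v s l))"
    for m A
  proof -
    have "cdot (y m) (A *v y m)
      = (\<Sum>k<N. \<Sum>l<N. cnj (w m (real k)) * (w m (real l) * cdot (s k) (A *v s l)))"
      by (simp add: y_def vec.sum vec.scale cdot_sum_left cdot_sum_right cdot_scale_left
          cdot_scale_right sum_distrib_left)
        (subst sum.swap, simp add: mult.left_commute)
    also have "\<dots> = (\<Sum>k<N. \<Sum>l<N. w m (real l - real k) * cdot (s k) (A *v s l))"
      by (simp add: w_cnj w_mult mult.assoc[symmetric])
    finally show ?thesis .
  qed
  have diag: "(\<Sum>m<M. cdot (y m) (y m)) = of_nat M * (\<Sum>k<N. cdot (s k) (s k))"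
    using discrete_fourier_average[of N 0 M "\<lambda>k l. cdot (s k) (s l)"] form[of _ "mat 1"] N
    by (simp add: w_def M_def)
  have off: "(\<Sum>m<M. w m (-1) * cdot (y m) (C *v y m)) = of_nat M * (\<Sum>k<N. cdot (s k) (C *v s (Suc k)))"
  proof -
    have "w m (-1) * cdot (y m) (C *v y m)
       = (\<Sum>k<N. \<Sum>l<N. w m (real l - real k - real 1) * cdot (s k) (C *v s l))" for m
      by (simp add: form sum_distrib_left w_mult mult.assoc[symmetric] algebra_simps)
    then show ?thesis
      using discrete_fourier_average[of N 1 M "\<lambda>k l. cdot (s k) (C *v s l)"] N
      by (simp add: w_def M_def)
  qed
  have "0 \<le> 2 * c * Re (cdot (y m) (y m)) + 2 * Re (w m (-1) * cdot (y m) (C *v y m))" for m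
  proof -
    have "- Re (w m (-1) * cdot (y m) (C *v y m)) \<le> cmod (w m (-1) * cdot (y m) (C *v y m))"
      using abs_Re_le_cmod abs_le_D2 by blast
    also have "\<dots> \<le> numerical_radius C * (norm (y m))\<^sup>2"
      by (simp add: norm_mult w_norm cmod_cdot_le_numerical_radius)
    also have "\<dots> \<le> c * (norm (y m))\<^sup>2"
      by (rule mult_right_mono[OF c]) simp
    finally show ?thesis by (simp add: norm_sq_eq_Re_cdot[of "y m"])
  qed
  then have "0 \<le> (\<Sum>m<M. 2 * c * Re (cdot (y m) (y m)) + 2 * Re (w m (-1) * cdot (y m) (C *v y m)))"
    by (rule sum_nonneg)
  also have "\<dots> = 2 * c * Re (\<Sum>m<M. cdot (y m) (y m))
      + 2 * Re (\<Sum>m<M. w m (-1) * cdot (y m) (C *v y m))"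
    by (simp only: sum.distrib sum_distrib_left Re_sum)
  also have "\<dots> = real M * toeplitz_form c C s"
    unfolding diag off
    by (subst toeplitz_form_eq_sum[where N = N])
      (simp_all add: N norm_sq_eq_Re_cdot sum.distrib sum_distrib_left algebra_simps)
  finally show ?thesis by (simp add: M_def zero_le_mult_iff)
qed

lemma toeplitz_form_parallelogram:
  fixes C :: "complex ^ 'n ^ 'n"
  assumes "finite {k. s k \<noteq> 0}" "finite {k. t k \<noteq> 0}"
  shows "toeplitz_form c C (\<lambda>k. s k + t k) + toeplitz_form c C (\<lambda>k. s k - t k)
       = 2 * toeplitz_form c C s + 2 * toeplitz_form c C t"
proof -
  obtain N1 N2 where "\<And>k. k \<ge> N1 \<Longrightarrow> s k = 0" "\<And>k. k \<ge> N2 \<Longrightarrow> t k = 0"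
    using assms finite_support_bound by metis
  then have N: "s k = 0" "t k = 0" if "k \<ge> max N1 N2" for k
    using that by auto
  have norm: "(norm (x + y))\<^sup>2 + (norm (x - y))\<^sup>2 = 2 * (norm x)\<^sup>2 + 2 * (norm y)\<^sup>2"
    for x y :: "complex ^ 'n"
    by (simp add: norm_sq_eq_Re_cdot cdot_add_left cdot_add_right cdot_diff_left cdot_diff_right)
  have form: "Re (cdot (x + y) (C *v (x' + y'))) + Re (cdot (x - y) (C *v (x' - y')))
      = 2 * Re (cdot x (C *v x')) + 2 * Re (cdot y (C *v y'))" for x y x' y'
    by (simp add: vec.add vec.diff cdot_add_left cdot_add_right cdot_diff_left cdot_diff_right)
  have pointwise: "2 * c * (norm (x + y))\<^sup>2 + 2 * Re (cdot (x + y) (C *v (x' + y')))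
      + (2 * c * (norm (x - y))\<^sup>2 + 2 * Re (cdot (x - y) (C *v (x' - y'))))
    = 2 * (2 * c * (norm x)\<^sup>2 + 2 * Re (cdot x (C *v x')))
      + 2 * (2 * c * (norm y)\<^sup>2 + 2 * Re (cdot y (C *v y')))" for x y x' y'
    using form[of x y x' y'] arg_cong[OF norm[of x y], of "\<lambda>r. 2 * c * r"]
    unfolding distrib_left by linarith
  have eqs: "toeplitz_form c C u
      = (\<Sum>k<max N1 N2. 2 * c * (norm (u k))\<^sup>2 + 2 * Re (cdot (u k) (C *v u (Suc k))))"
    if "\<And>k. k \<ge> max N1 N2 \<Longrightarrow> u k = 0" for u
    by (rule toeplitz_form_eq_sum) (rule that)
  have "toeplitz_form c C (\<lambda>k. s k + t k) = (\<Sum>k<max N1 N2. 2 * c * (norm (s k + t k))\<^sup>2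
        + 2 * Re (cdot (s k + t k) (C *v (s (Suc k) + t (Suc k)))))"
    by (rule eqs) (simp only: N add_0_right)
  moreover have "toeplitz_form c C (\<lambda>k. s k - t k) = (\<Sum>k<max N1 N2. 2 * c * (norm (s k - t k))\<^sup>2
        + 2 * Re (cdot (s k - t k) (C *v (s (Suc k) - t (Suc k)))))"
    by (rule eqs) (simp only: N diff_0_right)
  ultimately show ?thesis
    by (simp only: eqs[OF N(1)] eqs[OF N(2)] sum.distrib[symmetric] sum_distrib_left pointwise)
qed

lemma toeplitz_form_scale:
  assumes "finite {k. s k \<noteq> 0}"
  shows "toeplitz_form c C (\<lambda>k. a *s s k) = (cmod a)\<^sup>2 * toeplitz_form c C s"
proof -
  obtain N where N: "\<And>k. k \<ge> N \<Longrightarrow> s k = 0"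
    using finite_support_bound[OF assms] by blast
  have "cdot (a *s x) (C *v (a *s y)) = of_real ((cmod a)\<^sup>2) * cdot x (C *v y)" for x y
    by (simp only: complex_norm_square vec.scale cdot_scale_left cdot_scale_right mult_ac)
  then have *: "Re (cdot (a *s x) (C *v (a *s y))) = (cmod a)\<^sup>2 * Re (cdot x (C *v y))" for x y
    by (simp del: of_real_power)
  show ?thesis
    by (subst (1 2) toeplitz_form_eq_sum[where N = N])
      (simp_all add: N * norm_scale power_mult_distrib sum_distrib_left algebra_simps)
qed

lemma toeplitz_form_Cons:
  assumes "finite {k. t k \<noteq> 0}"
  shows "toeplitz_form c C (case_nat x t)
       = 2 * c * (norm x)\<^sup>2 + 2 * Re (cdot x (C *v t 0)) + toeplitz_form c C t"
proof -
  obtain N where N: "\<And>k. k \<ge> N \<Longrightarrow> t k = 0"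
    using finite_support_bound[OF assms] by blast
  have "case_nat x t k = 0" if "k \<ge> Suc N" for k
    using that N by (cases k) auto
  from toeplitz_form_eq_sum[OF this, where c = c and C = C] toeplitz_form_eq_sum[OF N, where c = c and C = C]
  show ?thesis by (simp add: sum.lessThan_Suc_shift del: sum.lessThan_Suc)
qed

section \<open>Minimizing out the tail\<close>

definition sequences_from :: "'a::zero \<Rightarrow> (nat \<Rightarrow> 'a) set" where
  "sequences_from x = {s. finite {k. s k \<noteq> 0} \<and> s 0 = x}"

definition toeplitz_min :: "real \<Rightarrow> complex ^ 'n ^ 'n \<Rightarrow> complex ^ 'n \<Rightarrow> real" where
  "toeplitz_min c C x = (INF s\<in>sequences_from x. toeplitz_form c C s)"

lemma case_nat_in_sequences_from:
  assumes "t \<in> sequences_from y"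
  shows "case_nat x t \<in> sequences_from x"
proof -
  have "{k. case_nat x t k \<noteq> 0} \<subseteq> insert 0 (Suc ` {k. t k \<noteq> 0})"
  proof
    fix k assume "k \<in> {k. case_nat x t k \<noteq> 0}"
    then show "k \<in> insert 0 (Suc ` {k. t k \<noteq> 0})" by (cases k) auto
  qed
  then show ?thesis
    using assms finite_subset by (fastforce simp: sequences_from_def)
qed

lemma sequences_from_nonempty: "sequences_from x \<noteq> {}"
  using case_nat_in_sequences_from[of "\<lambda>_. 0" 0 x] by (auto simp: sequences_from_def)

lemma sequences_from_combine:
  assumes "s \<in> sequences_from x" "t \<in> sequences_from y" "h 0 0 = 0"
  shows "(\<lambda>k. h (s k) (t k)) \<in> sequences_from (h x y)"
proof -
  have "{k. h (s k) (t k) \<noteq> 0} \<subseteq> {k. s k \<noteq> 0} \<union> {k. t k \<noteq> 0}"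
    using assms(3) by auto
  then show ?thesis
    using assms(1,2) finite_subset by (fastforce simp: sequences_from_def)
qed

text \<open>
  The bound on the numerical radius makes the form bounded below; without it the infimum over the
  reals would carry no information.
\<close>

context
  fixes C :: "complex ^ 'n ^ 'n" and c :: real
  assumes c: "numerical_radius C \<le> c"
begin

lemma toeplitz_min_nonneg: "0 \<le> toeplitz_min c C x"
  unfolding toeplitz_min_def
  by (rule cINF_greatest[OF sequences_from_nonempty])
    (auto simp: sequences_from_def intro: toeplitz_form_nonneg c)

lemma toeplitz_min_le: "s \<in> sequences_from x \<Longrightarrow> toeplitz_min c C x \<le> toeplitz_form c C s"
  unfolding toeplitz_min_def
  by (rule cINF_lower)
    (auto simp: sequences_from_def intro!: bdd_belowI2[where m = 0] toeplitz_form_nonneg c)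

lemma toeplitz_min_greatest:
  "(\<And>s. s \<in> sequences_from x \<Longrightarrow> b \<le> toeplitz_form c C s) \<Longrightarrow> b \<le> toeplitz_min c C x"
  unfolding toeplitz_min_def by (rule cINF_greatest[OF sequences_from_nonempty])

text \<open>
  Prepending \<open>x\<close> to any sequence that starts in \<open>y\<close> gives a competitor for \<open>x\<close>, at the cost of one more
  diagonal term and one coupling. This is the inequality that becomes positivity of the block matrix.
\<close>

lemma toeplitz_min_Bellman:
  "toeplitz_min c C x \<le> 2 * c * (norm x)\<^sup>2 + 2 * Re (cdot x (C *v y)) + toeplitz_min c C y"
proof -
  have "toeplitz_min c C x - (2 * c * (norm x)\<^sup>2 + 2 * Re (cdot x (C *v y))) \<le> toeplitz_min c C y"
  proof (rule toeplitz_min_greatest)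
    fix t assume t: "t \<in> sequences_from y"
    from toeplitz_min_le[OF case_nat_in_sequences_from[OF t, of x]] t
    show "toeplitz_min c C x - (2 * c * (norm x)\<^sup>2 + 2 * Re (cdot x (C *v y))) \<le> toeplitz_form c C t"
      by (auto simp: toeplitz_form_Cons sequences_from_def)
  qed
  then show ?thesis by simp
qed

lemma toeplitz_min_scale: "toeplitz_min c C (a *s x) = (cmod a)\<^sup>2 * toeplitz_min c C x"
proof -
  \<comment> \<open>Scaling competitors gives one inequality; scaling back by the inverse gives the other.\<close>
  have le: "toeplitz_min c C (a *s x) \<le> (cmod a)\<^sup>2 * toeplitz_min c C x" if "a \<noteq> 0" for a x
  proof -
    have "toeplitz_min c C (a *s x) / (cmod a)\<^sup>2 \<le> toeplitz_min c C x"
    proof (rule toeplitz_min_greatest)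
      fix s assume s: "s \<in> sequences_from x"
      from toeplitz_min_le[OF sequences_from_combine[OF s s, of "\<lambda>u v. a *s u"]] s that
      show "toeplitz_min c C (a *s x) / (cmod a)\<^sup>2 \<le> toeplitz_form c C s"
        by (simp add: toeplitz_form_scale sequences_from_def field_simps)
    qed
    then show ?thesis using that by (simp add: field_simps)
  qed
  have "toeplitz_min c C 0 \<le> 0"
    using toeplitz_min_le[of "\<lambda>_. 0" 0] by (simp add: sequences_from_def toeplitz_form_def)
  then have zero: "toeplitz_min c C 0 = 0"
    using toeplitz_min_nonneg[of 0] by simp
  show ?thesis
  proof (cases "a = 0")
    case False
    have "toeplitz_min c C x \<le> (inverse (cmod a))\<^sup>2 * toeplitz_min c C (a *s x)"
      using le[of "inverse a" "a *s x"] False by (simp add: norm_inverse)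
    then have "(cmod a)\<^sup>2 * toeplitz_min c C x \<le> toeplitz_min c C (a *s x)"
      using False by (simp add: field_simps)
    with le[OF False, of x] show ?thesis by simp
  qed (simp add: zero)
qed

text \<open>
  If \<open>s\<close> and \<open>t\<close> compete for \<open>x\<close> and \<open>y\<close>, then \<open>s + t\<close> and \<open>s - t\<close> compete for \<open>x + y\<close> and \<open>x - y\<close>, so the
  parallelogram law of the Toeplitz form yields one inequality. Applied to \<open>x + y\<close> and \<open>x - y\<close>, it
  yields the reverse one by homogeneity.
\<close>

lemma toeplitz_min_parallelogram:
  "toeplitz_min c C (x + y) + toeplitz_min c C (x - y)
     = 2 * toeplitz_min c C x + 2 * toeplitz_min c C y"
proof -
  let ?q = "toeplitz_min c C"
  have le: "?q (x + y) + ?q (x - y) \<le> 2 * ?q x + 2 * ?q y" for x y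
  proof -
    have "(?q (x + y) + ?q (x - y) - 2 * ?q x) / 2 \<le> ?q y"
    proof (rule toeplitz_min_greatest)
      fix t assume t: "t \<in> sequences_from y"
      have "(?q (x + y) + ?q (x - y) - 2 * toeplitz_form c C t) / 2 \<le> ?q x"
      proof (rule toeplitz_min_greatest)
        fix s assume s: "s \<in> sequences_from x"
        have "?q (x + y) + ?q (x - y)
          \<le> toeplitz_form c C (\<lambda>k. s k + t k) + toeplitz_form c C (\<lambda>k. s k - t k)"
          using sequences_from_combine[OF s t, of "(+)"] sequences_from_combine[OF s t, of "(-)"]
          by (intro add_mono toeplitz_min_le) simp_all
        also have "\<dots> = 2 * toeplitz_form c C s + 2 * toeplitz_form c C t"
          using s t by (intro toeplitz_form_parallelogram) (auto simp: sequences_from_def)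
        finally show "(?q (x + y) + ?q (x - y) - 2 * toeplitz_form c C t) / 2 \<le> toeplitz_form c C s"
          by simp
      qed
      then show "(?q (x + y) + ?q (x - y) - 2 * ?q x) / 2 \<le> toeplitz_form c C t"
        by (simp add: field_simps)
    qed
    then show ?thesis by (simp add: field_simps)
  qed
  have "(x + y) + (x - y) = 2 *s x" "(x + y) - (x - y) = 2 *s y"
    by (simp_all add: vec_eq_iff)
  then have "4 * ?q x + 4 * ?q y \<le> 2 * ?q (x + y) + 2 * ?q (x - y)"
    using le[of "x + y" "x - y"] toeplitz_min_scale[of 2] by simp
  with le[of x y] show ?thesis by simp
qed

lemma toeplitz_min_matrix:
  obtains X where "X \<in> herm_mats" "\<And>x. cdot x (X *v x) = complex_of_real (toeplitz_min c C x)"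
proof -
  have "\<bar>toeplitz_min c C x\<bar> \<le> 2 * c * (norm x)\<^sup>2" for x
    using toeplitz_min_Bellman[of x 0] toeplitz_min_nonneg[of x] toeplitz_min_scale[of 0 x]
    by simp
  with toeplitz_min_parallelogram toeplitz_min_scale show ?thesis
    by (rule Hermitian_matrix_of_quadratic_form) (rule that)
qed

end

section \<open>Block matrices and the numerical radius\<close>

lemma scaleR_matrix_vector_mult: "(c *\<^sub>R A) *v x = c *\<^sub>R (A *v x)"
  for A :: "complex ^ 'n ^ 'm"
  unfolding vec_eq_iff matrix_vector_mult_def
  by (simp add: scaleR_sum_right)

lemma scaleR_eq_scale: "c *\<^sub>R x = of_real c *s x" for x :: "complex ^ 'n"
  by (simp add: vec_eq_iff scaleR_conv_of_real[where 'a = complex])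

lemma cdot_scaleR_mat: "cdot x ((c *\<^sub>R mat 1) *v x) = of_real (c * (norm x)\<^sup>2)"
  by (simp add: scaleR_matrix_vector_mult scaleR_eq_scale cdot_scale_right cdot_self)

text \<open>
  The test vector \<open>v\<close> has blocks \<open>x\<close> and \<open>a x\<close>, with \<open>x\<close> a maximizer for the numerical radius and the
  phase \<open>a\<close> chosen so that the two off-diagonal contributions are as negative as possible.
\<close>

lemma psd_block_imp_numerical_radius_le:
  fixes C :: "complex ^ 'n ^ 'n"
  assumes "block_mat (c *\<^sub>R mat 1 + Z) C (ctranspose C) (c *\<^sub>R mat 1 - Z) \<in> psd_mats"
  shows "numerical_radius C \<le> c"
proof -
  obtain x where x: "norm x = 1" "cmod (cdot x (C *v x)) = numerical_radius C"
    using numerical_radius_attained by blast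
  define z where "z = cdot x (C *v x)"
  obtain a where a: "cmod a = 1" "a * z = - of_real (cmod z)"
  proof (cases "z = 0")
    case True
    then show ?thesis using that[of 1] by simp
  next
    case False
    then have "cnj z / of_real (cmod z) * z = of_real (cmod z)"
      using complex_norm_square[of z] by (simp add: field_simps power2_eq_square)
    then show ?thesis using that[of "- (cnj z / of_real (cmod z))"] False
      by (simp add: norm_divide)
  qed
  define v :: "complex ^ ('n + 'n)" where
    "v = (\<chi> i. case i of Inl p \<Rightarrow> x $ p | Inr p \<Rightarrow> (a *s x) $ p)"
  have v: "(\<chi> p. v $ Inl p) = x" "(\<chi> p. v $ Inr p) = a *s x"
    by (simp_all add: v_def vec_eq_iff)
  have aa: "a * cnj a = 1"
    using a(1) complex_norm_square[of a] by simp
  let ?M = "block_mat (c *\<^sub>R mat 1 + Z) C (ctranspose C) (c *\<^sub>R mat 1 - Z)"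
  have form: "cdot v (?M *v v) = cdot x ((c *\<^sub>R mat 1 + Z) *v x) + a * z + cnj (a * z)
      + a * cnj a * cdot x ((c *\<^sub>R mat 1 - Z) *v x)"
    by (simp only: cdot_block_mat v cdot_ctranspose vec.scale cdot_scale_left cdot_scale_right
        z_def mult.assoc)
  have "0 \<le> Re (cdot v (?M *v v))"
    using assms unfolding psd_mats_def by blast
  also have "\<dots> = 2 * c - 2 * cmod z"
    using x(1) by (simp only: form aa a(2)) (simp add: matrix_vector_mult_add_rdistrib
        matrix_vector_mult_diff_rdistrib cdot_add_right cdot_diff_right cdot_scaleR_mat)
  finally show ?thesis using x(2) by (simp add: z_def)
qed

text \<open>
  With \<open>Z = c I - X\<close> the diagonal blocks are \<open>2 c I - X\<close> and \<open>X\<close>. Where \<open>X\<close> represents the minimized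
  Toeplitz form, positivity of the block matrix is literally its Bellman inequality.
\<close>

lemma numerical_radius_le_imp_psd_block:
  fixes C :: "complex ^ 'n ^ 'n"
  assumes "numerical_radius C \<le> c"
  shows "\<exists>Z \<in> herm_mats.
    block_mat (c *\<^sub>R mat 1 + Z) C (ctranspose C) (c *\<^sub>R mat 1 - Z) \<in> psd_mats"
proof -
  obtain X where X: "X \<in> herm_mats" "\<And>x. cdot x (X *v x) = complex_of_real (toeplitz_min c C x)"
    using toeplitz_min_matrix[OF assms] by blast
  define Z where "Z = c *\<^sub>R mat 1 - X"
  have ct: "ctranspose (A + B) = ctranspose A + ctranspose B"
    "ctranspose (A - B) = ctranspose A - ctranspose B"
    "ctranspose (c *\<^sub>R mat 1) = c *\<^sub>R mat 1" "ctranspose (ctranspose A) = A"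
    for A B :: "complex ^ 'n ^ 'n" and c :: real
    by (auto simp: ctranspose_def vec_eq_iff mat_def)
  have Z: "Z \<in> herm_mats"
    using X(1) by (simp add: herm_mats_def Z_def ct)
  let ?M = "block_mat (c *\<^sub>R mat 1 + Z) C (ctranspose C) (c *\<^sub>R mat 1 - Z)"
  have "0 \<le> Re (cdot v (?M *v v))" for v
  proof -
    define x y where "x = (\<chi> p. v $ Inl p)" and "y = (\<chi> p. v $ Inr p)"
    have Zform: "cdot u (Z *v u) = of_real (c * (norm u)\<^sup>2 - toeplitz_min c C u)" for u
      by (simp only: Z_def matrix_vector_mult_diff_rdistrib cdot_diff_right cdot_scaleR_mat X(2)
          of_real_diff)
    have "Re (cdot v (?M *v v))
      = 2 * c * (norm x)\<^sup>2 - toeplitz_min c C x + 2 * Re (cdot x (C *v y)) + toeplitz_min c C y"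
      unfolding cdot_block_mat cdot_ctranspose
      by (simp add: matrix_vector_mult_add_rdistrib matrix_vector_mult_diff_rdistrib
          cdot_add_right cdot_diff_right cdot_scaleR_mat Zform flip: x_def y_def
          del: of_real_power)
    with toeplitz_min_Bellman[OF assms, of x y] show ?thesis by simp
  qed
  moreover have "?M \<in> herm_mats"
    using Z by (simp add: herm_mats_def ctranspose_block_mat ct)
  ultimately show ?thesis using Z by (auto simp: psd_mats_def)
qed

theorem theorem3p4:
  fixes C :: "complex ^ 'n ^ 'n"
  shows "is_minimum
           {c :: real. \<exists>Z \<in> herm_mats.
              block_mat (c *\<^sub>R mat 1 + Z) C (ctranspose C) (c *\<^sub>R mat 1 - Z) \<in> psd_mats}
           (numerical_radius C)"
  using numerical_radius_le_imp_psd_block[of C] psd_block_imp_numerical_radius_le[of _ _ C]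
  by (auto simp: is_minimum_def)

end
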